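(* Fix $\alpha\in(0,1)$ and $B\in\mathbb N$. Suppose that $E^{\mathrm{test}}$ is an e-variable for $P_0$ and that $(E^{\mathrm{test}},E_1^{\mathrm{ref}},\ldots,E_B^{\mathrm{ref}})$ are exchangeable. Then $$\mathbb E_{P_0}[\phi_{\alpha,B}]\le\alpha .$$ If the common null distribution of $E^{\mathrm{test}},E_1^{\mathrm{ref}},\ldots,E_B^{\mathrm{ref}}$ is continuous, then it also holds that $$\mathbb E_{P_0}[\phi_{\alpha,B}]\ge\alpha-\frac1{B+1}.$$
   Context: $P_0$ is the null distribution. An e-variable for $P_0$ is a nonnegative random variable $E$ with $\mathbb E_{P_0}[E]\le1$. $E_1^{\mathrm{ref}},\ldots,E_B^{\mathrm{ref}}$ are reference e-values generated under $P_0$, and $E^{\mathrm{test}}$ is the e-value computed from the test observation; exchangeability is understood under $P_0$. $E^{\mathrm{ref}}_{(1)}\le\cdots\le E^{\mathrm{ref}}_{(B)}$ denote the order statistics of the reference e-values, with the convention $E^{\mathrm{ref}}_{(B+1)}:=+\infty$. Set $k_{\alpha,B}:=\lceil(1-\alpha)(B+1)\rceil$, let $\widehat c_{\alpha,B}:=E^{\mathrm{ref}}_{(k_{\alpha,B})}$ be the reference-null calibrated threshold, and let $\phi_{\alpha,B}:=\mathbf 1\{E^{\mathrm{test}}>\widehat c_{\alpha,B}\}$ be the test, which rejects the null when $\phi_{\alpha,B}=1$. Expectations are over all the randomness, including that of the reference e-values.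
   Formalization: The lower bound additionally assumes that almost surely no two of the test and reference e-values coincide; with only a continuous common distribution it fails, e.g. if all e-values equal one uniform variable on [0,1], B=9, α=1/2. *)

theory Defs
  imports "HOL-Probability.Probability" "HOL-Combinatorics.Permutations"
begin

text \<open>
  The measure \<open>M\<close> carries all the randomness under the null. The nonnegative integral is used
  because the Bochner integral of a non-integrable function is \<open>0\<close>.
\<close>
definition e_variable :: "'a measure \<Rightarrow> ('a \<Rightarrow> real) \<Rightarrow> bool" where
  "e_variable M E \<longleftrightarrow>
     E \<in> borel_measurable M \<and> (\<forall>\<omega>\<in>space M. 0 \<le> E \<omega>) \<and> (\<integral>\<^sup>+ \<omega>. ennreal (E \<omega>) \<partial>M) \<le> 1"

definition exchangeable :: "'a measure \<Rightarrow> 'i set \<Rightarrow> ('i \<Rightarrow> 'a \<Rightarrow> real) \<Rightarrow> bool" where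
  "exchangeable M I X \<longleftrightarrow>
     (\<forall>i\<in>I. X i \<in> borel_measurable M) \<and>
     (\<forall>\<pi>. \<pi> permutes I \<longrightarrow>
        distr M (\<Pi>\<^sub>M i\<in>I. borel) (\<lambda>\<omega>. \<lambda>i\<in>I. X (\<pi> i) \<omega>) =
        distr M (\<Pi>\<^sub>M i\<in>I. borel) (\<lambda>\<omega>. \<lambda>i\<in>I. X i \<omega>))"

text \<open>The value \<open>\<infinity>\<close> outside \<open>{1..B}\<close> only matters at \<open>k = B + 1\<close>.\<close>
definition order_statistic :: "nat \<Rightarrow> (nat \<Rightarrow> real) \<Rightarrow> nat \<Rightarrow> ereal" where
  "order_statistic B x k =
     (if k \<in> {1..B} then ereal (sort (map x [1..<Suc B]) ! (k - 1)) else \<infinity>)"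

definition calibration_index :: "real \<Rightarrow> nat \<Rightarrow> nat" where
  "calibration_index \<alpha> B = nat \<lceil>(1 - \<alpha>) * (real B + 1)\<rceil>"

definition calibrated_threshold :: "real \<Rightarrow> nat \<Rightarrow> (nat \<Rightarrow> 'a \<Rightarrow> real) \<Rightarrow> 'a \<Rightarrow> ereal" where
  "calibrated_threshold \<alpha> B Eref \<omega> =
     order_statistic B (\<lambda>i. Eref i \<omega>) (calibration_index \<alpha> B)"

definition calibrated_test ::
    "real \<Rightarrow> nat \<Rightarrow> ('a \<Rightarrow> real) \<Rightarrow> (nat \<Rightarrow> 'a \<Rightarrow> real) \<Rightarrow> 'a \<Rightarrow> real" where
  "calibrated_test \<alpha> B Etest Eref \<omega> =
     of_bool (ereal (Etest \<omega>) > calibrated_threshold \<alpha> B Eref \<omega>)"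

definition continuous_distribution :: "'a measure \<Rightarrow> ('a \<Rightarrow> real) \<Rightarrow> bool" where
  "continuous_distribution M X \<longleftrightarrow> continuous_on UNIV (cdf (distr M borel X))"

text \<open>
  For exchangeable variables, continuity of the common marginal law alone does not exclude ties:
  if all of them equal one uniform variable on \<open>[0, 1]\<close>, the test never rejects, and the lower
  bound fails whenever \<open>\<alpha> > 1 / (B + 1)\<close>. The absence of ties is what the lower bound uses; given
  a continuous marginal law it is automatic for i.i.d. variables, and it holds whenever the joint
  law has a Lebesgue density.
\<close>
definition almost_surely_no_ties :: "'a measure \<Rightarrow> 'i set \<Rightarrow> ('i \<Rightarrow> 'a \<Rightarrow> real) \<Rightarrow> bool" where
  "almost_surely_no_ties M I X \<longleftrightarrow> (AE \<omega> in M. inj_on (\<lambda>i. X i \<omega>) I)"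

end

theory Submission
  imports Defs
begin

text \<open>
  Put the test value at index \<open>0\<close> and let the rank of \<open>X\<^sub>j\<close> be the number of the \<open>B + 1\<close> values
  strictly below it. The test rejects exactly when the rank of \<open>X\<^sub>0\<close> is at least \<open>k\<close>. For every
  outcome at most \<open>B + 1 - k\<close> indices have rank at least \<open>k\<close>, with equality if there are no ties,
  and by exchangeability each index is equally likely to be one of them. Averaging gives a rejection
  probability of at most (without ties, exactly) \<open>(B + 1 - k) / (B + 1)\<close>.
\<close>

section \<open>Combinatorics of strict ranks\<close>

definition strict_rank :: "'i set \<Rightarrow> ('i \<Rightarrow> 'b::linorder) \<Rightarrow> 'i \<Rightarrow> nat" where
  "strict_rank I f j = card {i\<in>I. f i < f j}"

text \<open>The bijection \<open>\<pi>\<close> carries the indices counted on the left onto those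
  counted on the right. This is how a relabelling of the variables moves a rank event from one index
  to another.\<close>

lemma strict_rank_permutes:
  assumes "\<pi> permutes I"
  shows "strict_rank I (f \<circ> \<pi>) j = strict_rank I f (\<pi> j)"
proof -
  have "\<pi> ` {i\<in>I. f (\<pi> i) < f (\<pi> j)} = {i\<in>I. f i < f (\<pi> j)}"
  proof (intro equalityI subsetI)
    fix i assume i: "i \<in> {i\<in>I. f i < f (\<pi> j)}"
    then obtain l where "l \<in> I" "i = \<pi> l"
      using permutes_image[OF assms] by blast
    with i show "i \<in> \<pi> ` {i\<in>I. f (\<pi> i) < f (\<pi> j)}" by auto
  qed (use permutes_in_image[OF assms] in auto)
  moreover have "inj_on \<pi> {i\<in>I. f (\<pi> i) < f (\<pi> j)}"
    using permutes_inj[OF assms] by (rule inj_on_subset) simp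
  ultimately show ?thesis
    unfolding strict_rank_def comp_def by (metis card_image)
qed

lemma strict_rank_cong:
  assumes "\<And>i. i \<in> I \<Longrightarrow> f i = g i" and "j \<in> I"
  shows "strict_rank I f j = strict_rank I g j"
  using assms unfolding strict_rank_def by (intro arg_cong[where f = card]) auto

lemma strict_rank_less_card:
  assumes "finite I" and "j \<in> I"
  shows "strict_rank I f j < card I"
  unfolding strict_rank_def using assms by (intro psubset_card_mono) auto

lemma strict_rank_strict_mono:
  assumes "finite I" and "j \<in> I" and "f j < f l"
  shows "strict_rank I f j < strict_rank I f l"
  unfolding strict_rank_def using assms by (intro psubset_card_mono) auto

text \<open>Among the indices of rank at least \<open>k\<close>, choose \<open>m\<close> with the
  smallest value. The indices strictly below \<open>m\<close> number at least \<open>k\<close>, and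
  by minimality none of them is among the chosen ones, so the two disjoint sets fit into
  \<open>I\<close> together. If no index has rank at least \<open>k\<close>, the claim is the
  assumption on \<open>k\<close>.\<close>

lemma card_strict_rank_ge_le:
  assumes "finite I" and "k \<le> card I"
  shows "card {j\<in>I. k \<le> strict_rank I f j} + k \<le> card I"
proof (cases "{j\<in>I. k \<le> strict_rank I f j} = {}")
  case True
  then show ?thesis using assms by (simp only: card.empty add_0)
next
  case False
  let ?J = "{j\<in>I. k \<le> strict_rank I f j}"
  have "finite ?J" using assms by simp
  then obtain m where m: "m \<in> ?J" "\<And>j. j \<in> ?J \<Longrightarrow> f m \<le> f j"
    using ex_min_if_finite[of "f ` ?J"] False by (force simp: not_less)
  let ?L = "{i\<in>I. f i < f m}"
  have "k \<le> card ?L" using m(1) by (simp add: strict_rank_def)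
  moreover have "card ?J + card ?L = card (?J \<union> ?L)"
    using assms m(2) by (subst card_Un_disjoint) (auto simp: not_less[symmetric])
  moreover have "card (?J \<union> ?L) \<le> card I"
    using assms by (intro card_mono) auto
  ultimately show ?thesis by linarith
qed

text \<open>Distinct values have distinct ranks, so the rank maps \<open>I\<close> bijectively onto
  the numbers below \<open>card I\<close>, and counting ranks at least \<open>k\<close> is counting
  an interval. For \<open>k\<close> beyond \<open>card I\<close> both sides are 0 by truncated
  subtraction.\<close>

lemma card_strict_rank_ge_eq:
  fixes f :: "'i \<Rightarrow> 'b::linorder"
  assumes "finite I" and "inj_on f I"
  shows "card {j\<in>I. k \<le> strict_rank I f j} = card I - k"
proof -
  have inj: "inj_on (strict_rank I f) I"
  proof (rule inj_onI)
    fix i j assume ij: "i \<in> I" "j \<in> I" "strict_rank I f i = strict_rank I f j"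
    then have "f i = f j"
      using strict_rank_strict_mono[OF assms(1), of i f j]
        strict_rank_strict_mono[OF assms(1), of j f i]
      by (cases "f i" "f j" rule: linorder_cases) auto
    with assms ij show "i = j" by (auto dest: inj_onD)
  qed
  have "strict_rank I f ` I \<subseteq> {..<card I}"
    using strict_rank_less_card[OF assms(1)] by auto
  then have img: "strict_rank I f ` I = {..<card I}"
    using inj by (intro card_subset_eq) (auto simp: card_image)
  have "strict_rank I f ` {j\<in>I. k \<le> strict_rank I f j} = {j \<in> strict_rank I f ` I. k \<le> j}"
    by auto
  also have "\<dots> = {k..<card I}"
    unfolding img by auto
  finally have "card (strict_rank I f ` {j\<in>I. k \<le> strict_rank I f j}) = card I - k"
    by simp
  then show ?thesis
    using inj_on_subset[OF inj, of "{j\<in>I. k \<le> strict_rank I f j}"] by (simp add: card_image)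
qed

section \<open>Order statistics as counts\<close>

lemma sorted_nth_less_iff:
  fixes xs :: "'a::linorder list"
  assumes "sorted xs" and "m < length xs"
  shows "xs ! m < t \<longleftrightarrow> m < length (filter (\<lambda>x. x < t) xs)"
  using assms
proof (induction xs arbitrary: m)
  case (Cons x xs)
  show ?case
  proof (cases "x < t")
    case True
    with Cons show ?thesis by (cases m) auto
  next
    \<comment> \<open>Sortedness makes the head least, so no entry lies below \<open>t\<close> and
      both sides are false.\<close>
    case False
    with Cons.prems(1) have "\<forall>y\<in>set (x # xs). \<not> y < t" by auto
    moreover from this have "filter (\<lambda>x. x < t) (x # xs) = []"
      by (simp only: filter_empty_conv not_False_eq_True)
    ultimately show ?thesis
      using nth_mem[OF Cons.prems(2)] by (simp only: list.size) auto
  qed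
qed simp

text \<open>Sorting preserves the number of entries below \<open>t\<close>, and in a sorted list
  these form an initial segment. For \<open>k\<close> above \<open>B\<close> the default infinity
  makes the left side false, in agreement with the count. At \<open>k = 0\<close> the same default
  would break the equivalence, hence the assumption.\<close>

lemma order_statistic_less_iff:
  assumes "1 \<le> k"
  shows "order_statistic B x k < ereal t \<longleftrightarrow> k \<le> card {i\<in>{1..B}. x i < t}"
proof (cases "k \<le> B")
  case True
  let ?xs = "map x [1..<Suc B]"
  have "length (filter (\<lambda>y. y < t) (sort ?xs)) = length (filter (\<lambda>i. x i < t) [1..<Suc B])"
    by (simp only: filter_sort length_sort filter_map length_map comp_def)
  also have "\<dots> = card {i\<in>{1..B}. x i < t}"
    by (subst distinct_card[symmetric]) (auto intro: arg_cong[where f = card])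
  finally show ?thesis
    using True assms sorted_nth_less_iff[of "sort ?xs" "k - 1" t]
    by (auto simp: order_statistic_def)
next
  case False
  have "card {i\<in>{1..B}. x i < t} \<le> card {1..B}"
    by (intro card_mono) auto
  with False show ?thesis
    by (auto simp: order_statistic_def)
qed

section \<open>Rank events under exchangeability\<close>

lemma measurable_strict_rank:
  fixes X :: "'i \<Rightarrow> 'a \<Rightarrow> real"
  assumes "finite I" and "\<And>i. i \<in> I \<Longrightarrow> X i \<in> borel_measurable M" and "j \<in> I"
  shows "{\<omega>\<in>space M. k \<le> strict_rank I (\<lambda>i. X i \<omega>) j} \<in> sets M"
proof -
  have "real (strict_rank I (\<lambda>i. X i \<omega>) j) = (\<Sum>i\<in>I. if X i \<omega> < X j \<omega> then 1 else 0)" for \<omega>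
    using assms(1) by (simp add: strict_rank_def sum.If_cases Int_def conj_commute)
  moreover have "(\<lambda>\<omega>. \<Sum>i\<in>I. if X i \<omega> < X j \<omega> then 1 else 0 :: real) \<in> borel_measurable M"
    using assms(2,3) by (intro borel_measurable_sum) measurable
  ultimately have "(\<lambda>\<omega>. real (strict_rank I (\<lambda>i. X i \<omega>) j)) \<in> borel_measurable M"
    by simp
  then have "{\<omega>\<in>space M. real k \<le> real (strict_rank I (\<lambda>i. X i \<omega>) j)} \<in> sets M"
    by measurable
  then show ?thesis by simp
qed

text \<open>Both events are preimages of one set \<open>?S\<close> in the product space: under the
  original vector and under the vector with \<open>j\<close> and \<open>l\<close> transposed.
  Exchangeability gives these two vectors the same law.\<close>

lemma exchangeable_measure_strict_rank:
  fixes X :: "'i \<Rightarrow> 'a \<Rightarrow> real"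
  assumes "exchangeable M I X" and "finite I" and "j \<in> I" and "l \<in> I"
  shows "measure M {\<omega>\<in>space M. k \<le> strict_rank I (\<lambda>i. X i \<omega>) j} =
    measure M {\<omega>\<in>space M. k \<le> strict_rank I (\<lambda>i. X i \<omega>) l}"
proof -
  let ?N = "\<Pi>\<^sub>M i\<in>I. (borel :: real measure)"
  let ?S = "{x\<in>space ?N. k \<le> strict_rank I x j}"
  have X: "X i \<in> borel_measurable M" if "i \<in> I" for i
    using assms(1) that by (auto simp: exchangeable_def)
  \<comment> \<open>The measurability lemma is applied to the product space itself, with the
    coordinate projections as variables.\<close>
  have S: "?S \<in> sets ?N"
    using measurable_strict_rank[of I "\<lambda>i x. x i" ?N j k] assms by simp
  have distr_S: "measure (distr M ?N (\<lambda>\<omega>. \<lambda>i\<in>I. X (\<pi> i) \<omega>)) ?S =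
      measure M {\<omega>\<in>space M. k \<le> strict_rank I (\<lambda>i. X i \<omega>) (\<pi> j)}" if \<pi>: "\<pi> permutes I" for \<pi>
  proof -
    have meas: "(\<lambda>\<omega>. \<lambda>i\<in>I. X (\<pi> i) \<omega>) \<in> measurable M ?N"
      using X permutes_in_image[OF \<pi>] by (intro measurable_restrict) auto
    \<comment> \<open>The restricted function is \<open>undefined\<close> outside \<open>I\<close>;
      ranks only see values on \<open>I\<close>, so it may be replaced by a composition with
      \<open>\<pi>\<close>.\<close>
    have "strict_rank I (\<lambda>i\<in>I. X (\<pi> i) \<omega>) j = strict_rank I (\<lambda>i. X i \<omega>) (\<pi> j)" for \<omega>
      using strict_rank_cong[of I "\<lambda>i\<in>I. X (\<pi> i) \<omega>" "(\<lambda>i. X i \<omega>) \<circ> \<pi>" j]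
        strict_rank_permutes[OF \<pi>, of "\<lambda>i. X i \<omega>" j] assms(3) by simp
    then have "(\<lambda>\<omega>. \<lambda>i\<in>I. X (\<pi> i) \<omega>) -` ?S \<inter> space M =
        {\<omega>\<in>space M. k \<le> strict_rank I (\<lambda>i. X i \<omega>) (\<pi> j)}"
      using measurable_space[OF meas] by auto
    then show ?thesis
      using measure_distr[OF meas S] by simp
  qed
  have swap: "Transposition.transpose j l permutes I"
    using assms(3,4) by (rule permutes_swap_id)
  have "measure (distr M ?N (\<lambda>\<omega>. \<lambda>i\<in>I. X i \<omega>)) ?S =
      measure M {\<omega>\<in>space M. k \<le> strict_rank I (\<lambda>i. X i \<omega>) j}"
    using distr_S[OF permutes_id] by (simp only: id_apply)
  moreover have "measure (distr M ?N (\<lambda>\<omega>. \<lambda>i\<in>I. X (Transposition.transpose j l i) \<omega>)) ?S =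
      measure M {\<omega>\<in>space M. k \<le> strict_rank I (\<lambda>i. X i \<omega>) l}"
    using distr_S[OF swap] by (simp only: transpose_apply_first)
  moreover have "distr M ?N (\<lambda>\<omega>. \<lambda>i\<in>I. X (Transposition.transpose j l i) \<omega>) =
      distr M ?N (\<lambda>\<omega>. \<lambda>i\<in>I. X i \<omega>)"
    using assms(1) swap unfolding exchangeable_def by blast
  ultimately show ?thesis
    by (simp only:)
qed

text \<open>The number of indices of rank at least \<open>k\<close> is a sum of indicators, whose
  expectations are all equal by exchangeability. Pointwise bounds on this count thus become bounds
  on the probability for a single index.\<close>

lemma (in prob_space) exchangeable_prob_strict_rank:
  fixes X :: "'i \<Rightarrow> 'a \<Rightarrow> real"
  assumes "exchangeable M I X" and "finite I" and "j \<in> I"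
  shows "real (card I) * prob {\<omega>\<in>space M. k \<le> strict_rank I (\<lambda>i. X i \<omega>) j} =
    expectation (\<lambda>\<omega>. real (card {l\<in>I. k \<le> strict_rank I (\<lambda>i. X i \<omega>) l}))"
    and "integrable M (\<lambda>\<omega>. real (card {l\<in>I. k \<le> strict_rank I (\<lambda>i. X i \<omega>) l}))"
proof -
  let ?A = "\<lambda>l. {\<omega>\<in>space M. k \<le> strict_rank I (\<lambda>i. X i \<omega>) l}"
  have A: "?A l \<in> events" if "l \<in> I" for l
    using assms that by (intro measurable_strict_rank) (auto simp: exchangeable_def)
  then have int: "integrable M (indicator (?A l) :: 'a \<Rightarrow> real)" if "l \<in> I" for l
    using that by (intro integrable_real_indicator) (auto simp: less_top[symmetric])
  have card: "real (card {l\<in>I. k \<le> strict_rank I (\<lambda>i. X i \<omega>) l}) = (\<Sum>l\<in>I. indicator (?A l) \<omega>)"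
    if "\<omega> \<in> space M" for \<omega>
    using that assms(2) by (simp add: indicator_def of_bool_def sum.If_cases Int_def conj_commute)
  show "integrable M (\<lambda>\<omega>. real (card {l\<in>I. k \<le> strict_rank I (\<lambda>i. X i \<omega>) l}))"
    using int by (subst Bochner_Integration.integrable_cong[OF refl card]) auto
  have "real (card I) * prob (?A j) = (\<Sum>l\<in>I. prob (?A l))"
    using exchangeable_measure_strict_rank[OF assms(1,2) _ assms(3)] by simp
  also have "\<dots> = expectation (\<lambda>\<omega>. \<Sum>l\<in>I. indicator (?A l) \<omega>)"
    using A int by (subst Bochner_Integration.integral_sum) auto
  also have "\<dots> = expectation (\<lambda>\<omega>. real (card {l\<in>I. k \<le> strict_rank I (\<lambda>i. X i \<omega>) l}))"
    by (rule Bochner_Integration.integral_cong[OF refl card[symmetric]])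
  finally show "real (card I) * prob (?A j) =
      expectation (\<lambda>\<omega>. real (card {l\<in>I. k \<le> strict_rank I (\<lambda>i. X i \<omega>) l}))" .
qed

section \<open>The calibrated test as a rank event\<close>

lemma calibrated_test_eq_strict_rank:
  assumes "1 \<le> calibration_index \<alpha> B"
  shows "calibrated_test \<alpha> B Etest Eref \<omega> =
    of_bool (calibration_index \<alpha> B \<le> strict_rank {0..B} (\<lambda>i. (Eref(0 := Etest)) i \<omega>) 0)"
proof -
  \<comment> \<open>Strictness keeps index 0 out of its own count, so the rank of the test value
    counts reference values only.\<close>
  have "{i\<in>{0..B}. (Eref(0 := Etest)) i \<omega> < Etest \<omega>} = {i\<in>{1..B}. Eref i \<omega> < Etest \<omega>}"
    by (auto simp: fun_upd_def Suc_le_eq split: if_splits)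
  then show ?thesis
    using order_statistic_less_iff[OF assms, of B "\<lambda>i. Eref i \<omega>" "Etest \<omega>"]
    by (simp add: calibrated_test_def calibrated_threshold_def strict_rank_def)
qed

theorem theorem2p1:
  fixes P\<^sub>0 :: "'a measure"
    and \<alpha> :: real
    and B :: nat
    and Etest :: "'a \<Rightarrow> real"
    and Eref :: "nat \<Rightarrow> 'a \<Rightarrow> real"
  assumes "prob_space P\<^sub>0"
    and "0 < \<alpha>" and "\<alpha> < 1"
    and "e_variable P\<^sub>0 Etest"
    and "exchangeable P\<^sub>0 {0..B} (Eref(0 := Etest))"
  shows "prob_space.expectation P\<^sub>0 (calibrated_test \<alpha> B Etest Eref) \<le> \<alpha> \<and>
    (continuous_distribution P\<^sub>0 Etest \<and>
     almost_surely_no_ties P\<^sub>0 {0..B} (Eref(0 := Etest)) \<longrightarrow>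
       prob_space.expectation P\<^sub>0 (calibrated_test \<alpha> B Etest Eref) \<ge> \<alpha> - 1 / (real B + 1))"
proof -
  interpret prob_space P\<^sub>0 by fact
  let ?I = "{0..B}" and ?X = "Eref(0 := Etest)"
  define k where "k = calibration_index \<alpha> B"
  define p where "p = expectation (calibrated_test \<alpha> B Etest Eref)"
  define N where "N \<omega> = card {l\<in>?I. k \<le> strict_rank ?I (\<lambda>i. ?X i \<omega>) l}" for \<omega>
  \<comment> \<open>Positivity, from \<alpha> < 1, gives \<open>k\<close> at least 1; the upper
    bound, from \<alpha> > 0, keeps the ceiling within \<open>B + 1\<close>.\<close>
  have "0 < (1 - \<alpha>) * (real B + 1)" "(1 - \<alpha>) * (real B + 1) \<le> real B + 1"
    using assms(2,3) by (auto intro!: mult_pos_pos mult_left_le_one_le)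
  then have k: "1 \<le> k" "k \<le> B + 1"
    and k_lower: "(1 - \<alpha>) * (real B + 1) \<le> k" and k_upper: "k < (1 - \<alpha>) * (real B + 1) + 1"
    unfolding k_def calibration_index_def by linarith+
  let ?A = "{\<omega>\<in>space P\<^sub>0. k \<le> strict_rank ?I (\<lambda>i. ?X i \<omega>) 0}"
  have "calibrated_test \<alpha> B Etest Eref \<omega> = indicator ?A \<omega>" if "\<omega> \<in> space P\<^sub>0" for \<omega>
    using that calibrated_test_eq_strict_rank[OF k(1)[unfolded k_def], of Etest Eref \<omega>]
    by (simp only: k_def indicator_def) simp
  then have "p = expectation (indicator ?A)"
    unfolding p_def by (intro Bochner_Integration.integral_cong) auto
  then have "p = prob ?A"
    by (simp add: Int_absorb2 subset_eq)
  then have p: "(real B + 1) * p = expectation (\<lambda>\<omega>. real (N \<omega>))"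
    and int: "integrable P\<^sub>0 (\<lambda>\<omega>. real (N \<omega>))"
    using exchangeable_prob_strict_rank[OF assms(5), of 0 k]
    by (simp_all add: N_def algebra_simps del: fun_upd_apply)
  have "real (N \<omega>) \<le> real B + 1 - k" for \<omega>
    using card_strict_rank_ge_le[of ?I k "\<lambda>i. ?X i \<omega>"] k(2) by (simp add: N_def)
  then have "(real B + 1) * p \<le> real B + 1 - k"
    unfolding p using int by (intro integral_le_const) auto
  also have "\<dots> \<le> (real B + 1) * \<alpha>"
    using k_lower by (simp add: algebra_simps)
  finally have upper: "p \<le> \<alpha>"
    by simp
  have lower: "\<alpha> - 1 / (real B + 1) \<le> p" if ties: "almost_surely_no_ties P\<^sub>0 ?I ?X"
  proof -
    \<comment> \<open>Where there are no ties the count equals \<open>B + 1 - k\<close>; this is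
      known only almost everywhere, which suffices for the integral.\<close>
    have "AE \<omega> in P\<^sub>0. real B + 1 - k \<le> real (N \<omega>)"
      using ties unfolding almost_surely_no_ties_def
    proof eventually_elim
      case (elim \<omega>)
      then show ?case
        using card_strict_rank_ge_eq[of ?I "\<lambda>i. ?X i \<omega>" k] k(2) by (simp add: N_def of_nat_diff)
    qed
    then have "real B + 1 - k \<le> (real B + 1) * p"
      unfolding p using int by (intro integral_ge_const) auto
    \<comment> \<open>The ceiling exceeds its argument by less than 1; divided by
      \<open>B + 1\<close>, this rounding error is the gap below \<alpha>.\<close>
    then have "(real B + 1) * \<alpha> - 1 \<le> (real B + 1) * p"
      using k_upper by (simp add: algebra_simps)
    then show ?thesis
      by (simp add: field_simps)
  qed
  show ?thesis
    using upper lower unfolding p_def by blast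
qed

end
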